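(* Let $q\in\mathbb N$, let $\mathbb I\subseteq\mathbb N$ with $0<|\mathbb I|<\infty$, let $\mathcal B|_{\mathbb I},\mathcal B'|_{\mathbb I}\in\mathsf L_{\mathrm{fin}}^q$ be finite-horizon linear behaviors (with $\mathcal B,\mathcal B'\in\mathsf L^q$), and let $d$ be one of the metrics $d_\kappa$ (chordal), $d_\gamma$ (Grassmann), $d_\pi$ (Procrustes). Then $$d(Q\cdot\mathcal B|_{\mathbb I},\,Q\cdot\mathcal B'|_{\mathbb I})=d(\mathcal B|_{\mathbb I},\mathcal B'|_{\mathbb I})$$ for all orthogonal matrices $Q\in \mathrm O(q|\mathbb I|)$.
   Context: $\mathbb N$ is the set of positive integers. A system, identified with its behavior $\mathcal B$, is a subset of $(\mathbb R^q)^{\mathbb N}$; it is linear if it is a linear subspace, and a linear system is complete if it is closed in the topology of pointwise convergence. $\mathsf L^q$ is the set of all complete linear systems $\mathcal B\subseteq(\mathbb R^q)^{\mathbb N}$. For $\mathbb I\subseteq\mathbb N$, $\mathcal B|_{\mathbb I}=\{w|_{\mathbb I}:w\in\mathcal B\}$, and $\mathsf L^q_{\mathrm{fin}}=\{\mathcal B|_{\mathbb I}:\mathcal B\in\mathsf L^q,\ \mathbb I\subseteq\mathbb N,\ 0<|\mathbb I|<\infty\}$. Stacking the values $w(t)$, $t\in\mathbb I$, in increasing order of $t$ identifies $(\mathbb R^q)^{\mathbb I}$ with $\mathbb R^{q|\mathbb I|}$, so $\mathcal B|_{\mathbb I}$ is a linear subspace of $\mathbb R^{q|\mathbb I|}$.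 $\mathrm O(N)$ is the group of $N\times N$ orthogonal matrices, acting on subspaces of $\mathbb R^N$ by $Q\cdot\mathcal V=\operatorname{im}(QV)$, where $V$ has orthonormal columns and $\mathcal V=\operatorname{im}V$ (i.e. $Q\cdot\mathcal V=\{Qv:v\in\mathcal V\}$). For subspaces $\mathcal V,\mathcal U$ of $\mathbb R^N$ with $k=\dim\mathcal V$, $l=\dim\mathcal U$ and principal angles $\theta_i=\theta_i(\mathcal V,\mathcal U)\in[0,\pi/2]$, $i=1,\dots,\min(k,l)$, $$d_\kappa(\mathcal V,\mathcal U)=\Big(|k-l|+\sum_{i=1}^{\min(k,l)}(\sin\theta_i)^2\Big)^{1/2},$$ $$d_\gamma(\mathcal V,\mathcal U)=\Big(|k-l|\tfrac{\pi^2}{4}+\sum_{i=1}^{\min(k,l)}\theta_i^2\Big)^{1/2},$$ $$d_\pi(\mathcal V,\mathcal U)=\Big(|k-l|+2\sum_{i=1}^{\min(k,l)}\big(\sin\tfrac{\theta_i}{2}\big)^2\Big)^{1/2},$$ with empty sums equal to $0$. *)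

theory Defs
  imports "HOL-Analysis.Abstract_Euclidean_Space" "Jordan_Normal_Form.VS_Connect"
begin

section \<open>Complete linear systems and their restrictions\<close>

text \<open>
  Time runs through the positive integers. A signal is an extensional function on the time axis
  with values in the points of \<^term>\<open>Euclidean_space q\<close>, i.e. real sequences vanishing from index
  \<open>q\<close> on. The product topology on signals is the topology of pointwise convergence.
\<close>

definition time_axis :: "nat set" where
  "time_axis = {1..}"

definition signal_topology :: "nat \<Rightarrow> (nat \<Rightarrow> nat \<Rightarrow> real) topology" where
  "signal_topology q = product_topology (\<lambda>t. Euclidean_space q) time_axis"

definition linear_system :: "nat \<Rightarrow> (nat \<Rightarrow> nat \<Rightarrow> real) set \<Rightarrow> bool" where
  "linear_system q B \<longleftrightarrow>
     B \<subseteq> topspace (signal_topology q) \<and>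
     (\<lambda>t\<in>time_axis. \<lambda>i. 0) \<in> B \<and>
     (\<forall>v\<in>B. \<forall>w\<in>B. (\<lambda>t\<in>time_axis. \<lambda>i. v t i + w t i) \<in> B) \<and>
     (\<forall>c. \<forall>w\<in>B. (\<lambda>t\<in>time_axis. \<lambda>i. c * w t i) \<in> B)"

definition complete_linear_systems :: "nat \<Rightarrow> (nat \<Rightarrow> nat \<Rightarrow> real) set set" where
  "complete_linear_systems q = {B. linear_system q B \<and> closedin (signal_topology q) B}"

definition restrict_behavior ::
  "(nat \<Rightarrow> nat \<Rightarrow> real) set \<Rightarrow> nat set \<Rightarrow> (nat \<Rightarrow> nat \<Rightarrow> real) set" where
  "restrict_behavior B I = (\<lambda>w. restrict w I) ` B"

definition finite_horizon_behaviors :: "nat \<Rightarrow> (nat \<Rightarrow> nat \<Rightarrow> real) set set" where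
  "finite_horizon_behaviors q =
     {restrict_behavior B I | B I.
        B \<in> complete_linear_systems q \<and> I \<subseteq> time_axis \<and> finite I \<and> 0 < card I}"

text \<open>
  Stacking the values in increasing order of time: entry \<open>j\<close> is component \<open>j mod q\<close> of the value at
  the time with (zero-based) rank \<open>j div q\<close> in \<open>I\<close>.
\<close>

definition stack :: "nat \<Rightarrow> nat set \<Rightarrow> (nat \<Rightarrow> nat \<Rightarrow> real) \<Rightarrow> real Matrix.vec" where
  "stack q I w =
     Matrix.vec (q * card I) (\<lambda>j. w (sorted_list_of_set I ! (j div q)) (j mod q))"

definition stack_behavior ::
  "nat \<Rightarrow> nat set \<Rightarrow> (nat \<Rightarrow> nat \<Rightarrow> real) set \<Rightarrow> real Matrix.vec set" where
  "stack_behavior q I W = stack q I ` W"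


section \<open>The orthogonal group and its action on subspaces\<close>

definition orthogonal_group :: "nat \<Rightarrow> real mat set" where
  "orthogonal_group N =
     {Q \<in> carrier_mat N N.
        transpose_mat Q * Q = 1\<^sub>m N \<and> Q * transpose_mat Q = 1\<^sub>m N}"

definition mat_act :: "real mat \<Rightarrow> real Matrix.vec set \<Rightarrow> real Matrix.vec set" where
  "mat_act Q V = {Q *\<^sub>v v | v. v \<in> V}"


section \<open>Principal angles and the three metrics\<close>

definition subspace_dim :: "nat \<Rightarrow> real Matrix.vec set \<Rightarrow> nat" where
  "subspace_dim N V =
     vectorspace.dim class_ring ((module_vec TYPE(real) N)\<lparr>carrier := V\<rparr>)"

text \<open>
  Principal vectors are chosen greedily: \<open>(p i, r i)\<close> maximises the inner product over all pairs of
  unit vectors \<open>x \<in> V\<close>, \<open>y \<in> U\<close> with \<open>x\<close> orthogonal to the earlier \<open>p j\<close> and \<open>y\<close> to the earlier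
  \<open>r j\<close>. The vectors are not unique, but the maxima attained, hence the angles, are.
\<close>

definition admissible_pair ::
  "real Matrix.vec set \<Rightarrow> real Matrix.vec set \<Rightarrow> (nat \<Rightarrow> real Matrix.vec) \<Rightarrow> (nat \<Rightarrow> real Matrix.vec)
   \<Rightarrow> nat \<Rightarrow> real Matrix.vec \<Rightarrow> real Matrix.vec \<Rightarrow> bool" where
  "admissible_pair V U p r i x y \<longleftrightarrow>
     x \<in> V \<and> y \<in> U \<and> scalar_prod x x = 1 \<and> scalar_prod y y = 1 \<and>
     (\<forall>j\<in>{1..<i}. scalar_prod x (p j) = 0 \<and> scalar_prod y (r j) = 0)"

definition principal_vectors ::
  "nat \<Rightarrow> real Matrix.vec set \<Rightarrow> real Matrix.vec set
   \<Rightarrow> (nat \<Rightarrow> real Matrix.vec) \<Rightarrow> (nat \<Rightarrow> real Matrix.vec) \<Rightarrow> bool" where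
  "principal_vectors N V U p r \<longleftrightarrow>
     (\<forall>i\<in>{1..min (subspace_dim N V) (subspace_dim N U)}.
        admissible_pair V U p r i (p i) (r i) \<and>
        (\<forall>x y. admissible_pair V U p r i x y \<longrightarrow> scalar_prod x y \<le> scalar_prod (p i) (r i)))"

definition principal_angle ::
  "nat \<Rightarrow> real Matrix.vec set \<Rightarrow> real Matrix.vec set \<Rightarrow> nat \<Rightarrow> real" where
  "principal_angle N V U i =
     (THE \<theta>. \<exists>p r. principal_vectors N V U p r \<and> \<theta> = arccos (scalar_prod (p i) (r i)))"

definition chordal_dist :: "nat \<Rightarrow> real Matrix.vec set \<Rightarrow> real Matrix.vec set \<Rightarrow> real" where
  "chordal_dist N V U =
     sqrt (\<bar>real (subspace_dim N V) - real (subspace_dim N U)\<bar>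
       + (\<Sum>i = 1..min (subspace_dim N V) (subspace_dim N U). (sin (principal_angle N V U i))\<^sup>2))"

definition Grassmann_dist :: "nat \<Rightarrow> real Matrix.vec set \<Rightarrow> real Matrix.vec set \<Rightarrow> real" where
  "Grassmann_dist N V U =
     sqrt (\<bar>real (subspace_dim N V) - real (subspace_dim N U)\<bar> * (pi\<^sup>2 / 4)
       + (\<Sum>i = 1..min (subspace_dim N V) (subspace_dim N U). (principal_angle N V U i)\<^sup>2))"

definition Procrustes_dist :: "nat \<Rightarrow> real Matrix.vec set \<Rightarrow> real Matrix.vec set \<Rightarrow> real" where
  "Procrustes_dist N V U =
     sqrt (\<bar>real (subspace_dim N V) - real (subspace_dim N U)\<bar>
       + 2 * (\<Sum>i = 1..min (subspace_dim N V) (subspace_dim N U).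
                (sin (principal_angle N V U i / 2))\<^sup>2))"

end

theory Submission
  imports Defs
begin

text \<open>
  An orthogonal matrix \<open>Q\<close> of size \<open>N\<close> is a linear bijection of \<open>\<real>\<^sup>N\<close> that preserves inner
  products (\<open>orthogonal_scalar_prod\<close>), with inverse \<open>Q\<^sup>T\<close>. All three distances between \<open>\<V>\<close> and
  \<open>\<U>\<close> are expressions in the two dimensions and the principal angles alone, so it suffices that
  both data are unchanged when \<open>Q\<close> is applied to \<open>\<V>\<close> and \<open>\<U>\<close> simultaneously.

  Dimensions are preserved because \<open>Q\<close> restricts to a linear isomorphism from \<open>\<V>\<close> onto
  \<open>Q \<cdot> \<V>\<close> (\<open>subspace_dim_mat_act\<close>). For the angles, the optimisation problem that selects the
  principal vectors of \<open>(Q \<cdot> \<V>, Q \<cdot> \<U>)\<close> is the one for \<open>(\<V>, \<U>)\<close> rewritten in the coordinates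
  given by \<open>Q\<close>: its constraints and its objective involve only membership in the two
  subspaces and inner products. Hence \<open>Q\<close> maps principal vectors to principal vectors (\<open>principal_vectors_mat_act\<close>), and \<open>Q\<^sup>T\<close> maps them back, so
  exactly the same values satisfy the description that defines the angle (\<open>principal_angle_mat_act\<close>).

  Stacking is linear in the signal, so stacked restricted behaviors are subspaces of \<open>\<real>\<^sup>N\<close> with
  \<open>N = q\<bar>\<I>\<bar>\<close> (\<open>subspace_stack_behavior\<close>) and the invariance for general subspaces applies.
\<close>

section \<open>Orthogonal matrices as linear isometries\<close>

lemma orthogonal_group_carrier: "Q \<in> orthogonal_group N \<Longrightarrow> Q \<in> carrier_mat N N"
  by (simp add: orthogonal_group_def)

lemma transpose_orthogonal_group:
  "Q \<in> orthogonal_group N \<Longrightarrow> transpose_mat Q \<in> orthogonal_group N"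
  by (simp add: orthogonal_group_def)

lemma orthogonal_transpose_cancel:
  assumes "Q \<in> orthogonal_group N" and "v \<in> carrier_vec N"
  shows "transpose_mat Q *\<^sub>v (Q *\<^sub>v v) = v"
proof -
  have "transpose_mat Q *\<^sub>v (Q *\<^sub>v v) = (transpose_mat Q * Q) *\<^sub>v v"
    using assms by (intro assoc_mult_mat_vec[symmetric]) (auto simp: orthogonal_group_def)
  then show ?thesis
    using assms by (simp add: orthogonal_group_def)
qed

lemma orthogonal_scalar_prod:
  assumes "Q \<in> orthogonal_group N" and "v \<in> carrier_vec N" and "w \<in> carrier_vec N"
  shows "(Q *\<^sub>v v) \<bullet> (Q *\<^sub>v w) = v \<bullet> w"
proof -
  have Q: "Q \<in> carrier_mat N N"
    using assms(1) by (rule orthogonal_group_carrier)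
  have "v \<bullet> w = (transpose_mat Q *\<^sub>v (Q *\<^sub>v v)) \<bullet> w"
    using assms by (simp add: orthogonal_transpose_cancel)
  also have "\<dots> = (Q *\<^sub>v v) \<bullet> (Q *\<^sub>v w)"
    using Q assms by (intro transpose_vec_mult_scalar) auto
  finally show ?thesis ..
qed

lemma inj_on_orthogonal:
  "Q \<in> orthogonal_group N \<Longrightarrow> inj_on (\<lambda>v. Q *\<^sub>v v) (carrier_vec N)"
  by (rule inj_on_inverseI[where g = "\<lambda>v. transpose_mat Q *\<^sub>v v"])
    (rule orthogonal_transpose_cancel)

lemma mat_act_eq_image: "mat_act Q V = (\<lambda>v. Q *\<^sub>v v) ` V"
  by (auto simp: mat_act_def)

lemma mat_act_carrier:
  assumes "Q \<in> orthogonal_group N" and "V \<subseteq> carrier_vec N"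
  shows "mat_act Q V \<subseteq> carrier_vec N"
  using assms by (auto simp: mat_act_def orthogonal_group_def)

lemma mat_act_transpose_cancel:
  assumes "Q \<in> orthogonal_group N" and "V \<subseteq> carrier_vec N"
  shows "mat_act (transpose_mat Q) (mat_act Q V) = V"
proof -
  have "(\<lambda>v. transpose_mat Q *\<^sub>v (Q *\<^sub>v v)) ` V = (\<lambda>v. v) ` V"
    using assms by (intro image_cong) (auto intro: orthogonal_transpose_cancel)
  then show ?thesis
    by (simp add: mat_act_eq_image image_image)
qed


section \<open>Invariance of the dimension\<close>

text \<open>
  A linearly independent subset of a subspace is linearly independent in \<open>\<real>\<^sup>N\<close>, so it has at most
  \<open>N\<close> elements; a maximal one therefore exists, and it spans the subspace.
\<close>

lemma subspace_fin_dim: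
  fixes V :: "real Matrix.vec set"
  assumes "submodule class_ring V (module_vec TYPE(real) N)"
  shows "vectorspace.fin_dim class_ring ((module_vec TYPE(real) N)\<lparr>carrier := V\<rparr>)"
proof -
  interpret E: vec_space "TYPE(real)" N .
  have "VectorSpace.subspace class_ring V (module_vec TYPE(real) N)"
    using assms E.vectorspace_axioms by (simp add: VectorSpace.subspace_def)
  then have vs: "vectorspace class_ring ((module_vec TYPE(real) N)\<lparr>carrier := V\<rparr>)"
    by (rule E.subspace_is_vs)
  interpret W: vectorspace class_ring "(module_vec TYPE(real) N)\<lparr>carrier := V\<rparr>"
    by (rule vs)
  have V: "V \<subseteq> carrier_vec N"
    using submodule.subset[OF assms] by (simp add: module_vec_def)
  have bound: "finite S \<and> card S \<le> N" if "S \<subseteq> V" "W.lin_indpt S" for S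
  proof -
    have "E.lin_indpt S"
      using that E.span_li_not_depend(2)[OF that(1) assms] by simp
    then show ?thesis
      using E.fin_dim E.li_le_dim[of S] that V by (auto simp: E.dim_is_n)
  qed
  let ?P = "\<lambda>S. S \<subseteq> V \<and> W.lin_indpt S"
  have "?P {}"
    by (auto simp: W.lin_dep_def)
  with bound obtain S where S: "finite S" "maximal S ?P"
    using maximal_exists[of ?P N "{}"] by auto
  then have "W.gen_set S"
    using W.max_li_is_gen[of S] by auto
  then show ?thesis
    unfolding W.fin_dim_def using S by (auto simp: maximal_def)
qed

lemma subspace_mat_act:
  assumes Q: "Q \<in> orthogonal_group N"
    and V: "submodule class_ring V (module_vec TYPE(real) N)"
  shows "submodule class_ring (mat_act Q V) (module_vec TYPE(real) N)"
proof -
  let ?E = "module_vec TYPE(real) N"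
  interpret E: vec_space "TYPE(real)" N .
  have Qc: "Q \<in> carrier_mat N N"
    using Q by (rule orthogonal_group_carrier)
  have sub: "V \<subseteq> carrier_vec N"
    using submodule.subset[OF V] by (simp add: module_vec_def)
  show ?thesis
  proof (rule submodule.intro)
    show "Module.module class_ring ?E"
      by (rule E.module_axioms)
    show "mat_act Q V \<subseteq> carrier ?E"
      using mat_act_carrier[OF Q sub] by simp
    show "\<zero>\<^bsub>?E\<^esub> \<in> mat_act Q V"
      using submodule.zero_closed[OF V] Qc
      by (auto simp: mat_act_def intro!: exI[of _ "0\<^sub>v N"])
    show "v \<oplus>\<^bsub>?E\<^esub> w \<in> mat_act Q V" if "v \<in> mat_act Q V" "w \<in> mat_act Q V" for v w
    proof -
      from that obtain a b where ab: "a \<in> V" "b \<in> V" "v = Q *\<^sub>v a" "w = Q *\<^sub>v b"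
        by (auto simp: mat_act_def)
      have "a + b \<in> V"
        using submodule.m_closed[OF V ab(1,2)] by simp
      moreover have "v + w = Q *\<^sub>v (a + b)"
        using ab sub Qc by (subst mult_add_distrib_mat_vec[of _ N N]) auto
      ultimately show ?thesis
        by (auto simp: mat_act_def)
    qed
    show "c \<odot>\<^bsub>?E\<^esub> v \<in> mat_act Q V" if "v \<in> mat_act Q V" for c v
    proof -
      from that obtain a where a: "a \<in> V" "v = Q *\<^sub>v a"
        by (auto simp: mat_act_def)
      have "c \<cdot>\<^sub>v a \<in> V"
        using submodule.smult_closed[OF V _ a(1), of c] by simp
      moreover have "c \<cdot>\<^sub>v v = Q *\<^sub>v (c \<cdot>\<^sub>v a)"
        using a sub Qc by (subst mult_mat_vec[of _ N N]) auto
      ultimately show ?thesis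
        by (auto simp: mat_act_def)
    qed
  qed
qed

lemma subspace_dim_mat_act:
  assumes Q: "Q \<in> orthogonal_group N"
    and V: "submodule class_ring V (module_vec TYPE(real) N)"
  shows "subspace_dim N (mat_act Q V) = subspace_dim N V"
proof -
  let ?E = "module_vec TYPE(real) N"
  interpret E: vec_space "TYPE(real)" N .
  have Qc: "Q \<in> carrier_mat N N"
    using Q by (rule orthogonal_group_carrier)
  have sub: "V \<subseteq> carrier_vec N"
    using submodule.subset[OF V] by (simp add: module_vec_def)
  have QV: "submodule class_ring (mat_act Q V) ?E"
    using Q V by (rule subspace_mat_act)
  let ?V = "?E\<lparr>carrier := V\<rparr>" and ?W = "?E\<lparr>carrier := mat_act Q V\<rparr>"
  have vsV: "vectorspace class_ring ?V" and vsW: "vectorspace class_ring ?W"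
    using V QV E.vectorspace_axioms
    by (auto simp: VectorSpace.subspace_def intro!: E.subspace_is_vs)
  have "(\<lambda>v. Q *\<^sub>v v) \<in> module_hom class_ring ?V ?W"
    using sub Qc
    by (auto simp: module_hom_def mat_act_def mult_add_distrib_mat_vec[of Q N N] mult_mat_vec[of Q N N] subset_iff)
  then interpret L: linear_map class_ring ?V ?W "\<lambda>v. Q *\<^sub>v v"
    using vsV vsW
    by (auto simp: linear_map_def mod_hom_def mod_hom_axioms_def vectorspace_def)
  have "L.V.dim = L.W.dim"
    using subspace_fin_dim[OF V] inj_on_subset[OF inj_on_orthogonal[OF Q] sub]
    by (intro L.dim_eq) (auto simp: mat_act_eq_image)
  then show ?thesis
    by (simp add: subspace_dim_def)
qed


section \<open>Invariance of the principal angles\<close>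

lemma admissible_pair_mat_act:
  assumes Q: "Q \<in> orthogonal_group N"
    and V: "V \<subseteq> carrier_vec N" and U: "U \<subseteq> carrier_vec N"
    and p: "\<And>j. j \<in> {1..<i} \<Longrightarrow> p j \<in> carrier_vec N \<and> r j \<in> carrier_vec N"
    and x: "x \<in> carrier_vec N" and y: "y \<in> carrier_vec N"
  shows "admissible_pair (mat_act Q V) (mat_act Q U) (\<lambda>j. Q *\<^sub>v p j) (\<lambda>j. Q *\<^sub>v r j) i
           (Q *\<^sub>v x) (Q *\<^sub>v y)
         \<longleftrightarrow> admissible_pair V U p r i x y"
proof -
  have "Q *\<^sub>v x \<in> mat_act Q V \<longleftrightarrow> x \<in> V" "Q *\<^sub>v y \<in> mat_act Q U \<longleftrightarrow> y \<in> U"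
    using inj_on_image_mem_iff[OF inj_on_orthogonal[OF Q]] V U x y
    by (auto simp: mat_act_eq_image)
  then show ?thesis
    using x y p by (auto simp: admissible_pair_def orthogonal_scalar_prod[OF Q])
qed

text \<open>
  Every competitor in the maximisation for the rotated subspaces is the rotation of a competitor for
  the original ones, with the same objective value.
\<close>

lemma principal_vectors_mat_act:
  assumes Q: "Q \<in> orthogonal_group N"
    and V: "submodule class_ring V (module_vec TYPE(real) N)"
    and U: "submodule class_ring U (module_vec TYPE(real) N)"
    and pr: "principal_vectors N V U p r"
  shows "principal_vectors N (mat_act Q V) (mat_act Q U) (\<lambda>j. Q *\<^sub>v p j) (\<lambda>j. Q *\<^sub>v r j)"
proof -
  let ?m = "min (subspace_dim N V) (subspace_dim N U)"
  have sub: "V \<subseteq> carrier_vec N" "U \<subseteq> carrier_vec N"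
    using submodule.subset[OF V] submodule.subset[OF U] by (simp_all add: module_vec_def)
  have adm: "admissible_pair V U p r i (p i) (r i)"
    and max: "\<And>x y. admissible_pair V U p r i x y \<Longrightarrow> x \<bullet> y \<le> p i \<bullet> r i"
    if "i \<in> {1..?m}" for i
    using pr that by (auto simp: principal_vectors_def)
  have car: "p i \<in> carrier_vec N \<and> r i \<in> carrier_vec N" if "i \<in> {1..?m}" for i
    using adm[OF that] sub by (auto simp: admissible_pair_def)
  show ?thesis
    unfolding principal_vectors_def subspace_dim_mat_act[OF Q V] subspace_dim_mat_act[OF Q U]
  proof (intro ballI conjI allI impI)
    fix i assume i: "i \<in> {1..?m}"
    have earlier: "p j \<in> carrier_vec N \<and> r j \<in> carrier_vec N" if "j \<in> {1..<i}" for j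
      using car that i by simp
    have iff: "admissible_pair (mat_act Q V) (mat_act Q U) (\<lambda>j. Q *\<^sub>v p j) (\<lambda>j. Q *\<^sub>v r j) i
        (Q *\<^sub>v a) (Q *\<^sub>v b) \<longleftrightarrow> admissible_pair V U p r i a b"
      if "a \<in> carrier_vec N" "b \<in> carrier_vec N" for a b
      using Q sub earlier that by (rule admissible_pair_mat_act)
    show "admissible_pair (mat_act Q V) (mat_act Q U) (\<lambda>j. Q *\<^sub>v p j) (\<lambda>j. Q *\<^sub>v r j) i
            (Q *\<^sub>v p i) (Q *\<^sub>v r i)"
      using iff car[OF i] adm[OF i] by blast
    fix x y
    assume xy: "admissible_pair (mat_act Q V) (mat_act Q U) (\<lambda>j. Q *\<^sub>v p j) (\<lambda>j. Q *\<^sub>v r j) i x y"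
    then obtain a b where ab: "a \<in> V" "b \<in> U" "x = Q *\<^sub>v a" "y = Q *\<^sub>v b"
      by (auto simp: admissible_pair_def mat_act_def)
    then have "admissible_pair V U p r i a b"
      using iff[of a b] xy sub by auto
    then have "a \<bullet> b \<le> p i \<bullet> r i"
      by (rule max[OF i])
    then show "x \<bullet> y \<le> (Q *\<^sub>v p i) \<bullet> (Q *\<^sub>v r i)"
      using ab sub car[OF i] by (auto simp: orthogonal_scalar_prod[OF Q] subset_iff)
  qed
qed

text \<open>
  Rotating back by \<open>Q\<^sup>T\<close> turns the forward transport of principal vectors into a correspondence, so
  the descriptions defining the two angles select the same reals. The index is bounded because
  \<open>p i\<close> and \<open>r i\<close> are confined to the subspaces, and so to \<open>\<real>\<^sup>N\<close>, only up to the smaller dimension.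
\<close>

lemma principal_angle_mat_act:
  assumes Q: "Q \<in> orthogonal_group N"
    and V: "submodule class_ring V (module_vec TYPE(real) N)"
    and U: "submodule class_ring U (module_vec TYPE(real) N)"
    and i: "i \<in> {1..min (subspace_dim N V) (subspace_dim N U)}"
  shows "principal_angle N (mat_act Q V) (mat_act Q U) i = principal_angle N V U i"
proof -
  \<comment> \<open>The set of candidate values for the angle can only grow under a rotation.\<close>
  have forward: "\<exists>p' r'. principal_vectors N (mat_act P X) (mat_act P Y) p' r' \<and>
        \<theta> = arccos (scalar_prod (p' i) (r' i))"
    if P: "P \<in> orthogonal_group N"
      and X: "submodule class_ring X (module_vec TYPE(real) N)"
      and Y: "submodule class_ring Y (module_vec TYPE(real) N)"
      and ix: "i \<in> {1..min (subspace_dim N X) (subspace_dim N Y)}"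
      and ex: "\<exists>p r. principal_vectors N X Y p r \<and> \<theta> = arccos (scalar_prod (p i) (r i))"
    for P X Y \<theta>
  proof -
    from ex obtain p r where pr: "principal_vectors N X Y p r" and \<theta>: "\<theta> = arccos (scalar_prod (p i) (r i))"
      by blast
    have "p i \<in> X" "r i \<in> Y"
      using pr ix by (auto simp: principal_vectors_def admissible_pair_def)
    then have "p i \<in> carrier_vec N" "r i \<in> carrier_vec N"
      using submodule.subset[OF X] submodule.subset[OF Y] by (auto simp: module_vec_def)
    then have "\<theta> = arccos (scalar_prod (P *\<^sub>v p i) (P *\<^sub>v r i))"
      using \<theta> by (simp add: orthogonal_scalar_prod[OF P])
    with principal_vectors_mat_act[OF P X Y pr] show ?thesis
      by blast
  qed
  have sub: "V \<subseteq> carrier_vec N" "U \<subseteq> carrier_vec N"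
    using submodule.subset[OF V] submodule.subset[OF U] by (simp_all add: module_vec_def)
  have "(\<exists>p r. principal_vectors N (mat_act Q V) (mat_act Q U) p r \<and> \<theta> = arccos (scalar_prod (p i) (r i)))
      \<longleftrightarrow> (\<exists>p r. principal_vectors N V U p r \<and> \<theta> = arccos (scalar_prod (p i) (r i)))" for \<theta>
  proof
    assume "\<exists>p r. principal_vectors N V U p r \<and> \<theta> = arccos (scalar_prod (p i) (r i))"
    then show "\<exists>p r. principal_vectors N (mat_act Q V) (mat_act Q U) p r \<and> \<theta> = arccos (scalar_prod (p i) (r i))"
      by (rule forward[OF Q V U i])
  next
    have iQ: "i \<in> {1..min (subspace_dim N (mat_act Q V)) (subspace_dim N (mat_act Q U))}"
      using i by (simp only: subspace_dim_mat_act[OF Q V] subspace_dim_mat_act[OF Q U])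
    assume "\<exists>p r. principal_vectors N (mat_act Q V) (mat_act Q U) p r \<and> \<theta> = arccos (scalar_prod (p i) (r i))"
    from forward[OF transpose_orthogonal_group[OF Q] subspace_mat_act[OF Q V]
        subspace_mat_act[OF Q U] iQ this]
    show "\<exists>p r. principal_vectors N V U p r \<and> \<theta> = arccos (scalar_prod (p i) (r i))"
      by (simp only: mat_act_transpose_cancel[OF Q sub(1)] mat_act_transpose_cancel[OF Q sub(2)])
  qed
  then show ?thesis
    by (simp add: principal_angle_def)
qed

lemma subspace_dists_mat_act:
  assumes Q: "Q \<in> orthogonal_group N"
    and V: "submodule class_ring V (module_vec TYPE(real) N)"
    and U: "submodule class_ring U (module_vec TYPE(real) N)"
  shows "chordal_dist N (mat_act Q V) (mat_act Q U) = chordal_dist N V U"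
    and "Grassmann_dist N (mat_act Q V) (mat_act Q U) = Grassmann_dist N V U"
    and "Procrustes_dist N (mat_act Q V) (mat_act Q U) = Procrustes_dist N V U"
  unfolding chordal_dist_def Grassmann_dist_def Procrustes_dist_def
    subspace_dim_mat_act[OF Q V] subspace_dim_mat_act[OF Q U]
  using principal_angle_mat_act[OF Q V U] by simp_all


section \<open>Stacked behaviors are subspaces\<close>

lemma stack_restrict_index:
  assumes "finite I" and "j < q * card I"
  shows "stack q I (restrict w I) $ j = w (sorted_list_of_set I ! (j div q)) (j mod q)"
    and "sorted_list_of_set I ! (j div q) \<in> I"
proof -
  have "j div q < card I"
    using assms(2) by (simp add: less_mult_imp_div_less mult.commute)
  then show "sorted_list_of_set I ! (j div q) \<in> I"
    using assms(1) nth_mem[of "j div q" "sorted_list_of_set I"] by simp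
  then show "stack q I (restrict w I) $ j = w (sorted_list_of_set I ! (j div q)) (j mod q)"
    using assms(2) by (simp add: stack_def)
qed

lemma subspace_stack_behavior:
  assumes B: "linear_system q B" and I: "I \<subseteq> time_axis" "finite I"
  shows "submodule class_ring (stack_behavior q I (restrict_behavior B I))
           (module_vec TYPE(real) (q * card I))"
proof -
  let ?N = "q * card I"
  let ?E = "module_vec TYPE(real) ?N"
  let ?S = "stack_behavior q I (restrict_behavior B I)"
  interpret E: vec_space "TYPE(real)" ?N .
  have S: "?S = (\<lambda>w. stack q I (restrict w I)) ` B"
    by (simp add: stack_behavior_def restrict_behavior_def image_image)
  have dim: "dim_vec (stack q I w) = ?N" for w
    by (simp add: stack_def)
  have time: "sorted_list_of_set I ! (j div q) \<in> time_axis" if "j < ?N" for j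
    using stack_restrict_index(2)[OF I(2) that] I(1) by auto
  \<comment> \<open>Below, \<open>restrict_restrict\<close> is disabled so that each stacked signal keeps the shape
    \<open>restrict w I\<close> from which the element \<open>w\<close> of \<open>B\<close> can be read off.\<close>
  note index = dim stack_restrict_index(1)[OF I(2)] time
  show ?thesis
  proof (rule submodule.intro)
    show "Module.module class_ring ?E"
      by (rule E.module_axioms)
    show "?S \<subseteq> carrier ?E"
      by (auto simp: S stack_def)
    have "0\<^sub>v ?N = stack q I (restrict (\<lambda>t\<in>time_axis. \<lambda>i. 0) I)"
      by (rule eq_vecI) (simp_all add: index del: restrict_restrict)
    then show "\<zero>\<^bsub>?E\<^esub> \<in> ?S"
      using B by (auto simp: S linear_system_def simp del: restrict_restrict)
    show "x \<oplus>\<^bsub>?E\<^esub> y \<in> ?S" if "x \<in> ?S" "y \<in> ?S" for x y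
    proof -
      from that obtain v w where vw: "v \<in> B" "w \<in> B"
        "x = stack q I (restrict v I)" "y = stack q I (restrict w I)"
        by (auto simp: S)
      then have "x + y = stack q I (restrict (\<lambda>t\<in>time_axis. \<lambda>i. v t i + w t i) I)"
        by (intro eq_vecI) (simp_all add: index del: restrict_restrict)
      then show ?thesis
        using B vw by (auto simp: S linear_system_def simp del: restrict_restrict)
    qed
    show "c \<odot>\<^bsub>?E\<^esub> x \<in> ?S" if "x \<in> ?S" for c x
    proof -
      from that obtain w where w: "w \<in> B" "x = stack q I (restrict w I)"
        by (auto simp: S)
      then have "c \<cdot>\<^sub>v x = stack q I (restrict (\<lambda>t\<in>time_axis. \<lambda>i. c * w t i) I)"
        by (intro eq_vecI) (simp_all add: index del: restrict_restrict)
      then show ?thesis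
        using B w by (auto simp: S linear_system_def simp del: restrict_restrict)
    qed
  qed
qed


section \<open>Invariance of the distances between behaviors\<close>

theorem theorem2:
  fixes q :: nat and I :: "nat set"
    and B B' :: "(nat \<Rightarrow> nat \<Rightarrow> real) set"
    and d :: "nat \<Rightarrow> real Matrix.vec set \<Rightarrow> real Matrix.vec set \<Rightarrow> real"
  assumes "1 \<le> q"
    and "I \<subseteq> time_axis" and "finite I" and "0 < card I"
    and "B \<in> complete_linear_systems q" and "B' \<in> complete_linear_systems q"
    and "restrict_behavior B I \<in> finite_horizon_behaviors q"
    and "restrict_behavior B' I \<in> finite_horizon_behaviors q"
    and "d \<in> {chordal_dist, Grassmann_dist, Procrustes_dist}"
  shows "\<forall>Q \<in> orthogonal_group (q * card I).
    d (q * card I)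
      (mat_act Q (stack_behavior q I (restrict_behavior B I)))
      (mat_act Q (stack_behavior q I (restrict_behavior B' I)))
    = d (q * card I)
      (stack_behavior q I (restrict_behavior B I))
      (stack_behavior q I (restrict_behavior B' I))"
proof
  fix Q assume "Q \<in> orthogonal_group (q * card I)"
  moreover have "linear_system q B" "linear_system q B'"
    using assms by (auto simp: complete_linear_systems_def)
  ultimately show "d (q * card I)
      (mat_act Q (stack_behavior q I (restrict_behavior B I)))
      (mat_act Q (stack_behavior q I (restrict_behavior B' I)))
    = d (q * card I)
      (stack_behavior q I (restrict_behavior B I))
      (stack_behavior q I (restrict_behavior B' I))"
    using assms subspace_dists_mat_act subspace_stack_behavior by auto
qed

end
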